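(* Let $\mathbb{X}$ be a $p$-Banach space, $0<p\le1$. If $\mathcal{X}=(x_n)_{n=1}^\infty$ is a nearly unconditional basis of $\mathbb{X}$, then there is a constant $K$ (independent of $m$) such that $$k_m[\mathcal{X},\mathbb{X}]\le K\,\lambda\!\left(\frac{1}{m^{1/p}}\right)(\log m)^{1/p},\qquad m\ge2.$$
   Context: $\mathbb{X}$ is an infinite-dimensional separable $p$-Banach space over the real or complex field, i.e., a quasi-Banach space whose quasi-norm satisfies $\|f+g\|^p\le\|f\|^p+\|g\|^p$. A basis of $\mathbb{X}$ is a norm-bounded sequence $\mathcal{X}=(x_n)_{n=1}^\infty$ with $\overline{\mathrm{span}}(x_n: n\in\mathbb{N})=\mathbb{X}$ for which there is a (unique) norm-bounded sequence $(x_n^* )_{n=1}^\infty$ in $\mathbb{X}^*$ such that $(x_n,x_n^* )_{n=1}^\infty$ is a biorthogonal system. For finite $A\subseteq\mathbb{N}$, $S_A(f)=\sum_{n\in A}x_n^*(f)\,x_n$, and the unconditionality constants are $k_m[\mathcal{X},\mathbb{X}]=\sup_{|A|\le m}\|S_A\|$, $m\in\mathbb{N}$. Put $\mathcal{Q}=\{f\in\mathbb{X}: \sup_n|x_n^*(f)|\le 1\}$ and, for $a>0$, $A(a,f)=\{n\in\mathbb{N}: |x_n^*(f)|\ge a\}$ (a finite set). The basis is nearly unconditional if for each $a\in(0,1)$ there is a constant $C$ such that $\|S_A(f)\|\le C\|f\|$ for all $f\in\mathcal{Q}$ and all $A\subseteq A(a,f)$. For $a\in(0,1)$ and $f\in\mathbb{X}$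 put $$\mathcal{R}^{(a)}(f)=\min_{n\in A(a,f)}|x_n^*(f)|\sum_{n\in A(a,f)}\mathrm{sign}(x_n^*(f))\,x_n$$ (equal to $0$ if $A(a,f)=\emptyset$), where $\mathrm{sign}(z)=z/|z|$ for $z\ne0$. The nearly truncation quasi-greedy function $\lambda$ of $\mathcal{X}$ is defined by letting $\lambda(a)$, $0<a<1$, be the smallest constant $C$ such that $\|\mathcal{R}^{(a)}(f)\|\le C\|f\|$ for all $f\in\mathcal{Q}$ (it is finite for nearly unconditional bases). *)

theory Defs
  imports "HOL-Analysis.Analysis"
begin

(* By the Gelfand-Mazur theorem, the fields in class real_normed_field are, up to
   isometric isomorphism, exactly the real and the complex numbers; both are instances.
   A polymorphic scalar field 'k of this class hence means "real or complex scalars". *)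

definition qdist :: "('a::ab_group_add \<Rightarrow> real) \<Rightarrow> real \<Rightarrow> 'a \<Rightarrow> 'a \<Rightarrow> real" where
  "qdist qnorm p f g = qnorm (f - g) powr p"

locale p_normed_space = vector_space smul
  for smul :: "'k::real_normed_field \<Rightarrow> 'a::ab_group_add \<Rightarrow> 'a" +
  fixes qnorm :: "'a \<Rightarrow> real" and p :: real
  assumes p_pos: "0 < p" and p_le_1: "p \<le> 1"
    and qnorm_nonneg: "0 \<le> qnorm f"
    and qnorm_eq_0_iff: "qnorm f = 0 \<longleftrightarrow> f = 0"
    and qnorm_smul: "qnorm (smul c f) = norm c * qnorm f"
    and qnorm_add: "qnorm (f + g) powr p \<le> qnorm f powr p + qnorm g powr p"
begin

lemma qnorm_uminus: "qnorm (- f) = qnorm f"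
  using qnorm_smul[of "- 1" f] by simp

lemma Metric_space_qdist: "Metric_space UNIV (qdist qnorm p)"
proof
  fix f g h :: 'a
  show "0 \<le> qdist qnorm p f g"
    by (simp add: qdist_def)
  show "qdist qnorm p f g = qdist qnorm p g f"
    using qnorm_uminus[of "f - g"] by (simp add: qdist_def)
  show "qdist qnorm p f g = 0 \<longleftrightarrow> f = g"
    by (simp add: qdist_def qnorm_eq_0_iff)
  show "qdist qnorm p f h \<le> qdist qnorm p f g + qdist qnorm p g h"
    using qnorm_add[of "f - g" "g - h"] by (simp add: qdist_def)
qed

end

abbreviation qtopology :: "('a::ab_group_add \<Rightarrow> real) \<Rightarrow> real \<Rightarrow> 'a topology" where
  "qtopology qnorm p \<equiv> Metric_space.mtopology UNIV (qdist qnorm p)"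

locale p_Banach_space = p_normed_space +
  assumes complete: "Metric_space.mcomplete UNIV (qdist qnorm p)"

locale separable_inf_dim_p_Banach_space = p_Banach_space +
  assumes separable: "separable_space (qtopology qnorm p)"
    and infinite_dim: "\<not> (\<exists>B. finite B \<and> span B = UNIV)"

(* The sequence xs of coordinate functionals is determined by x (linearity, continuity
   and density of the span), so it is carried as a parameter.  The bound in bounded_coords
   says that each xs n is in the dual space and that their dual norms are bounded. *)
locale p_Banach_basis = separable_inf_dim_p_Banach_space smul qnorm p
  for smul :: "'k::real_normed_field \<Rightarrow> 'a::ab_group_add \<Rightarrow> 'a"
    and qnorm :: "'a \<Rightarrow> real" and p :: real +
  fixes x :: "nat \<Rightarrow> 'a" and xs :: "nat \<Rightarrow> 'a \<Rightarrow> 'k"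
  assumes bounded_basis: "\<exists>C. \<forall>n. qnorm (x n) \<le> C"
    and dense_span: "qtopology qnorm p closure_of span (range x) = UNIV"
    and linear_coords: "\<And>n. Vector_Spaces.linear smul (*) (xs n)"
    and bounded_coords: "\<exists>C. \<forall>n f. norm (xs n f) \<le> C * qnorm f"
    and biorthogonal: "\<And>n k. xs n (x k) = (if n = k then 1 else 0)"

definition coord_proj ::
  "('k \<Rightarrow> 'a \<Rightarrow> 'a) \<Rightarrow> (nat \<Rightarrow> 'a) \<Rightarrow> (nat \<Rightarrow> 'a \<Rightarrow> 'k) \<Rightarrow> nat set \<Rightarrow> 'a \<Rightarrow> 'a::ab_group_add" where
  "coord_proj smul x xs A f = (\<Sum>n\<in>A. smul (xs n f) (x n))"

definition op_qnorm :: "('a \<Rightarrow> real) \<Rightarrow> ('a \<Rightarrow> 'a) \<Rightarrow> real" where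
  "op_qnorm qnorm T = (SUP f\<in>{f. qnorm f \<le> 1}. qnorm (T f))"

(* For a basis both suprema are over sets that are bounded above, so they are genuine. *)
definition unconditionality_const ::
  "('k \<Rightarrow> 'a \<Rightarrow> 'a) \<Rightarrow> ('a::ab_group_add \<Rightarrow> real) \<Rightarrow> (nat \<Rightarrow> 'a) \<Rightarrow> (nat \<Rightarrow> 'a \<Rightarrow> 'k) \<Rightarrow> nat \<Rightarrow> real" where
  "unconditionality_const smul qnorm x xs m =
    (SUP A\<in>{A. finite A \<and> card A \<le> m}. op_qnorm qnorm (coord_proj smul x xs A))"

definition coord_ball :: "(nat \<Rightarrow> 'a \<Rightarrow> 'k::real_normed_field) \<Rightarrow> 'a set" where
  "coord_ball xs = {f. \<forall>n. norm (xs n f) \<le> 1}"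

(* Finite for a > 0, since for a basis the coordinates of each vector tend to 0. *)
definition large_coords :: "(nat \<Rightarrow> 'a \<Rightarrow> 'k::real_normed_field) \<Rightarrow> real \<Rightarrow> 'a \<Rightarrow> nat set" where
  "large_coords xs a f = {n. a \<le> norm (xs n f)}"

definition nearly_unconditional ::
  "('k::real_normed_field \<Rightarrow> 'a \<Rightarrow> 'a) \<Rightarrow> ('a::ab_group_add \<Rightarrow> real) \<Rightarrow>
    (nat \<Rightarrow> 'a) \<Rightarrow> (nat \<Rightarrow> 'a \<Rightarrow> 'k) \<Rightarrow> bool" where
  "nearly_unconditional smul qnorm x xs \<longleftrightarrow>
    (\<forall>a\<in>{0<..<1}. \<exists>C. \<forall>f\<in>coord_ball xs. \<forall>A\<subseteq>large_coords xs a f.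
      qnorm (coord_proj smul x xs A f) \<le> C * qnorm f)"

definition restricted_truncation ::
  "('k::real_normed_field \<Rightarrow> 'a \<Rightarrow> 'a) \<Rightarrow> (nat \<Rightarrow> 'a) \<Rightarrow> (nat \<Rightarrow> 'a \<Rightarrow> 'k) \<Rightarrow>
    real \<Rightarrow> 'a \<Rightarrow> 'a::ab_group_add" where
  "restricted_truncation smul x xs a f =
    (if large_coords xs a f = {} then 0
     else smul (of_real (Min ((\<lambda>n. norm (xs n f)) ` large_coords xs a f)))
       (\<Sum>n\<in>large_coords xs a f. smul (sgn (xs n f)) (x n)))"

(* For a in (0,1) and a nearly unconditional basis the set is nonempty, closed and bounded
   below (by 0), so its infimum is its least element. *)
definition truncation_quasi_greedy_fun ::
  "('k::real_normed_field \<Rightarrow> 'a \<Rightarrow> 'a) \<Rightarrow> ('a::ab_group_add \<Rightarrow> real) \<Rightarrow>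
    (nat \<Rightarrow> 'a) \<Rightarrow> (nat \<Rightarrow> 'a \<Rightarrow> 'k) \<Rightarrow> real \<Rightarrow> real" where
  "truncation_quasi_greedy_fun smul qnorm x xs a =
    Inf {C. \<forall>f\<in>coord_ball xs. qnorm (restricted_truncation smul x xs a f) \<le> C * qnorm f}"

end

theory Submission
  imports Defs
begin

text \<open>Scale \<open>f\<close> into \<open>\<Q>\<close> and put \<open>b = m powr (-1/p)\<close>. The at most \<open>m\<close> terms of \<open>S\<^sub>A f\<close> with
  coefficients below \<open>b\<close> contribute a constant, by the \<open>p\<close>-triangle inequality. The remaining ones are
  split into about \<open>log m\<close> blocks on which the coefficients agree up to a factor \<open>2\<close>. On a block at
  level \<open>b t\<close>, binary expansion of the coefficients and near unconditionality (for vectors with unimodular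
  coordinates) give a bound by \<open>b t\<close> times the sum of \<open>sign(x\<^sub>n\<^sup>*(f)) x\<^sub>n\<close> over all of \<open>A(b t, f)\<close>, hence
  by \<open>\<lambda>(b)\<close>. The \<open>p\<close>-triangle inequality over the blocks yields the factor \<open>(log m) powr (1/p)\<close>.\<close>

section \<open>Convexity estimates in a \<open>p\<close>-normed space\<close>

context p_normed_space
begin

lemma qnorm_sum: "finite A \<Longrightarrow> qnorm (sum v A) powr p \<le> (\<Sum>n\<in>A. qnorm (v n) powr p)"
proof (induction A rule: finite_induct)
  case empty
  then show ?case using qnorm_eq_0_iff[of 0] by simp
next
  case (insert n A)
  then show ?case using qnorm_add[of "v n" "sum v A"] by simp
qed

lemma qnorm_sum_le:
  assumes "finite A" and "\<And>n. n \<in> A \<Longrightarrow> qnorm (v n) \<le> C"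
  shows "qnorm (sum v A) powr p \<le> real (card A) * C powr p"
proof -
  have "(\<Sum>n\<in>A. qnorm (v n) powr p) \<le> (\<Sum>n\<in>A. C powr p)"
    using assms(2) qnorm_nonneg p_pos by (intro sum_mono powr_mono2) auto
  then show ?thesis using qnorm_sum[OF assms(1), of v] by simp
qed

text \<open>Splitting off the leading binary digit of each coefficient, \<open>a = 1/2 (1\<^sub>B + a')\<close>, bounds the
  supremum over the box by half of itself, in the sense of \<open>p\<close>-th powers.\<close>

lemma qnorm_box_combination:
  fixes L :: "'i set"
  assumes fin: "finite L" and sub: "\<And>B. B \<subseteq> L \<Longrightarrow> qnorm (sum v B) \<le> M"
    and a: "\<And>n. n \<in> L \<Longrightarrow> 0 \<le> a n \<and> a n \<le> 1"
  shows "qnorm (\<Sum>n\<in>L. smul (of_real (a n)) (v n)) powr p \<le> M powr p / (2 powr p - 1)"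
proof -
  define P where "P = {a :: 'i \<Rightarrow> real. \<forall>n\<in>L. 0 \<le> a n \<and> a n \<le> 1}"
  define F where "F a = qnorm (\<Sum>n\<in>L. smul (of_real (a n)) (v n)) powr p" for a :: "'i \<Rightarrow> real"
  \<comment> \<open>This crude bound only serves to make the supremum \<open>s\<close> finite, so
    that it can be absorbed at the end.\<close>
  have "F a \<le> (\<Sum>n\<in>L. qnorm (v n) powr p)" if "a \<in> P" for a
  proof -
    have "(\<Sum>n\<in>L. qnorm (smul (of_real (a n)) (v n)) powr p) \<le> (\<Sum>n\<in>L. qnorm (v n) powr p)"
      using that qnorm_nonneg p_pos
      by (intro sum_mono powr_mono2) (auto simp: qnorm_smul P_def intro: mult_left_le_one_le)
    then show ?thesis
      using qnorm_sum[OF fin, of "\<lambda>n. smul (of_real (a n)) (v n)"] by (simp add: F_def)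
  qed
  then have bdd: "bdd_above (F ` P)" by (rule bdd_aboveI2)
  define s where "s = (SUP a\<in>P. F a)"
  have F_le: "F a \<le> s" if "a \<in> P" for a
    unfolding s_def using bdd that by (rule cSUP_upper2) auto
  have half: "F a \<le> (1/2) powr p * (M powr p + s)" if "a \<in> P" for a
  proof -
    define B where "B = {n\<in>L. 1/2 \<le> a n}"
    \<comment> \<open>The remainder after the leading digit, doubled, stays in the box, so
      \<open>F a'\<close> is again at most \<open>s\<close>.\<close>
    define a' where "a' n = 2 * a n - (if n \<in> B then 1 else 0)" for n
    have "a' \<in> P" using that by (auto simp: P_def a'_def B_def)
    have "smul (of_real (a n)) (v n)
        = smul (of_real (1/2)) ((if n \<in> B then v n else 0) + smul (of_real (a' n)) (v n))" for n
      by (simp add: a'_def scale_right_distrib scale_right_diff_distrib scale_left_diff_distrib)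
    then have "(\<Sum>n\<in>L. smul (of_real (a n)) (v n))
        = smul (of_real (1/2)) ((\<Sum>n\<in>L. if n \<in> B then v n else 0) + (\<Sum>n\<in>L. smul (of_real (a' n)) (v n)))"
      by (simp only: sum.distrib scale_sum_right[symmetric])
    also have "(\<Sum>n\<in>L. if n \<in> B then v n else 0) = sum v B"
      using fin by (simp add: sum.inter_filter[symmetric] B_def)
    finally have "F a = (1/2) powr p * qnorm (sum v B + (\<Sum>n\<in>L. smul (of_real (a' n)) (v n))) powr p"
      unfolding F_def using qnorm_nonneg by (simp add: qnorm_smul norm_divide powr_mult powr_divide)
    also have "\<dots> \<le> (1/2) powr p * (qnorm (sum v B) powr p + F a')"
      unfolding F_def by (intro mult_left_mono qnorm_add) auto
    also have "\<dots> \<le> (1/2) powr p * (M powr p + s)"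
      using F_le[OF \<open>a' \<in> P\<close>] sub[of B] qnorm_nonneg p_pos
      by (intro mult_left_mono add_mono powr_mono2) (auto simp: B_def)
    finally show ?thesis .
  qed
  have "a \<in> P" using a by (simp add: P_def)
  then have "s \<le> (1/2) powr p * (M powr p + s)"
    unfolding s_def using half by (intro cSUP_least) (auto simp: s_def)
  \<comment> \<open>As \<open>(1/2) powr p = 1 / 2 powr p\<close>, the term with \<open>s\<close>
    moves to the left; the resulting factor is positive because \<open>0 < p\<close>.\<close>
  then have "s * (2 powr p - 1) \<le> M powr p"
    by (simp add: powr_divide field_simps)
  moreover have "1 < 2 powr p" using p_pos by simp
  ultimately have "s \<le> M powr p / (2 powr p - 1)" by (simp add: field_simps)
  with F_le[OF \<open>a \<in> P\<close>] show ?thesis by (simp add: F_def)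
qed

text \<open>Taking \<open>p\<close>-th roots turns the preceding bound into a multiple of
  \<open>M\<close> whose factor depends on \<open>p\<close> only.\<close>

lemma qnorm_box_combination_le:
  assumes "finite L" and "\<And>B. B \<subseteq> L \<Longrightarrow> qnorm (sum v B) \<le> M"
    and "\<And>n. n \<in> L \<Longrightarrow> 0 \<le> a n \<and> a n \<le> 1"
  shows "qnorm (\<Sum>n\<in>L. smul (of_real (a n)) (v n)) \<le> (1 / (2 powr p - 1)) powr (1/p) * M"
proof -
  have M: "0 \<le> M" using assms(2)[of "{}"] qnorm_nonneg[of 0] by simp
  have "1 < 2 powr p" using p_pos by simp
  have "qnorm (\<Sum>n\<in>L. smul (of_real (a n)) (v n))
      = (qnorm (\<Sum>n\<in>L. smul (of_real (a n)) (v n)) powr p) powr (1/p)"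
    using p_pos qnorm_nonneg by (simp add: powr_powr)
  also have "\<dots> \<le> (1 / (2 powr p - 1) * M powr p) powr (1/p)"
    using qnorm_box_combination[OF assms] p_pos by (intro powr_mono2) auto
  also have "\<dots> = (1 / (2 powr p - 1)) powr (1/p) * M"
    using p_pos M \<open>1 < 2 powr p\<close> by (simp add: powr_mult powr_powr powr_divide)
  finally show ?thesis .
qed

end

lemma nearly_unconditionalE:
  assumes "nearly_unconditional smul qnorm x xs" and "0 < a" "a < 1"
  obtains C where "\<And>f A. f \<in> coord_ball xs \<Longrightarrow> A \<subseteq> large_coords xs a f \<Longrightarrow>
    qnorm (coord_proj smul x xs A f) \<le> C * qnorm f"
proof -
  have "\<exists>C. \<forall>f\<in>coord_ball xs. \<forall>A\<subseteq>large_coords xs a f.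
      qnorm (coord_proj smul x xs A f) \<le> C * qnorm f"
    using assms unfolding nearly_unconditional_def by simp
  then show thesis using that by blast
qed

section \<open>Coordinate functionals of a basis\<close>

context p_Banach_basis
begin

lemma coord_add: "xs n (f + g) = xs n f + xs n g"
  and coord_smul: "xs n (smul c f) = c * xs n f"
  using linear_coords[of n] by (auto simp: Vector_Spaces.linear_iff)

lemma coord_sum: "xs n (sum v A) = (\<Sum>k\<in>A. xs n (v k))"
proof (induction A rule: infinite_finite_induct)
qed (use coord_smul[of n 0 0] in \<open>auto simp: coord_add\<close>)

lemma coord_combination:
  assumes "finite A"
  shows "xs n (\<Sum>k\<in>A. smul (c k) (x k)) = (if n \<in> A then c n else 0)"
  using assms by (simp add: coord_sum coord_smul biorthogonal if_distrib cong: if_cong)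

lemma basis_nonzero: "x n \<noteq> 0"
  using biorthogonal[of n n] coord_smul[of n 0 0] by auto

text \<open>With \<open>D \<ge> 1\<close>, division by \<open>D\<close> maps the unit ball into
  \<open>coord_ball xs\<close> and into itself.\<close>

lemma coords_bound: "\<exists>D\<ge>1. \<forall>n f. norm (xs n f) \<le> D * qnorm f"
proof -
  obtain C where C: "\<And>n f. norm (xs n f) \<le> C * qnorm f" using bounded_coords by blast
  have "norm (xs n f) \<le> max C 1 * qnorm f" for n f
    using C[of n f] mult_right_mono[of C "max C 1" "qnorm f"] qnorm_nonneg by (auto intro: order_trans)
  then show ?thesis by (intro exI[of _ "max C 1"]) auto
qed

text \<open>Density supplies a finite combination \<open>h\<close> of basis vectors within
  \<open>a / D\<close> of \<open>f\<close>. Off a finite index set \<open>N\<close> the coordinates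
  of \<open>h\<close> vanish, so those of \<open>f\<close> agree with those of \<open>f - h\<close>
  and have modulus below \<open>a\<close>.\<close>

lemma finite_large_coords:
  assumes "0 < a"
  shows "finite (large_coords xs a f)"
proof -
  interpret Metric_space UNIV "qdist qnorm p" by (rule Metric_space_qdist)
  obtain D where "1 \<le> D" and D: "\<And>n f. norm (xs n f) \<le> D * qnorm f"
    using coords_bound by blast
  then have "0 < D" by simp
  have "0 < (a/D) powr p" using assms \<open>0 < D\<close> by simp
  moreover have "f \<in> mtopology closure_of span (range x)" using dense_span by simp
  ultimately obtain h where h: "h \<in> span (range x)" "qnorm (f - h) powr p < (a/D) powr p"
    unfolding metric_closure_of mball_def by (auto simp: qdist_def simp del: powr_gt_zero)
  then have "qnorm (f - h) < a/D"
    using p_pos assms \<open>0 < D\<close> powr_mono2[of p "a/D" "qnorm (f - h)"] by (cases "a/D \<le> qnorm (f - h)") auto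
  obtain T c where T: "finite T" "T \<subseteq> range x" "h = (\<Sum>v\<in>T. smul (c v) v)"
    using h(1) unfolding span_explicit by blast
  obtain N where N: "finite N" "T = x ` N" using T finite_subset_image by metis
  have "xs n h = 0" if "n \<notin> N" for n
    using that N biorthogonal by (auto simp: T(3) coord_sum coord_smul intro!: sum.neutral)
  then have "norm (xs n f) < a" if "n \<notin> N" for n
    using that coord_add[of n "f - h" h] D[of n "f - h"] \<open>qnorm (f - h) < a/D\<close> \<open>0 < D\<close>
    by (auto simp: field_simps)
  then have "large_coords xs a f \<subseteq> N" by (fastforce simp: large_coords_def)
  then show ?thesis using N(1) by (rule finite_subset)
qed


section \<open>The truncation function\<close>

text \<open>The truncation is a combination of the terms \<open>smul (xs n f) (x n)\<close> with
  weights \<open>\<mu> / norm (xs n f)\<close> in \<open>[0,1]\<close>, so near unconditionality and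
  the box bound apply. Hence the infimum defining the truncation function is over a nonempty
  set.\<close>

lemma truncation_bounded:
  assumes "nearly_unconditional smul qnorm x xs" and "0 < a" "a < 1"
  shows "\<exists>C. \<forall>f\<in>coord_ball xs. qnorm (restricted_truncation smul x xs a f) \<le> C * qnorm f"
proof -
  obtain C where C: "\<And>f A. f \<in> coord_ball xs \<Longrightarrow> A \<subseteq> large_coords xs a f \<Longrightarrow>
      qnorm (coord_proj smul x xs A f) \<le> C * qnorm f"
    using nearly_unconditionalE[OF assms] by blast
  define E where "E = (1 / (2 powr p - 1)) powr (1/p)"
  have "qnorm (restricted_truncation smul x xs a f) \<le> E * (C * qnorm f)"
    if f: "f \<in> coord_ball xs" for f
  proof (cases "large_coords xs a f = {}")
    case True
    \<comment> \<open>The sign of \<open>C\<close> is not known; the empty index set supplies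
      nonnegativity of the product.\<close>
    have "0 \<le> C * qnorm f" using C[OF f, of "{}"] qnorm_nonneg[of 0] by (auto simp: coord_proj_def)
    with True show ?thesis using qnorm_eq_0_iff[of 0] by (simp add: restricted_truncation_def E_def)
  next
    case False
    define L where "L = large_coords xs a f"
    define \<mu> where "\<mu> = Min ((\<lambda>n. norm (xs n f)) ` L)"
    have fin: "finite L" using finite_large_coords assms(2) by (simp add: L_def)
    have L: "a \<le> norm (xs n f)" if "n \<in> L" for n using that by (simp add: L_def large_coords_def)
    have "a \<le> \<mu>" using False fin L by (auto simp: \<mu>_def L_def[symmetric])
    have \<mu>: "\<mu> \<le> norm (xs n f)" if "n \<in> L" for n using that fin by (simp add: \<mu>_def)
    have "restricted_truncation smul x xs a f = (\<Sum>n\<in>L. smul (of_real \<mu>) (smul (sgn (xs n f)) (x n)))"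
      using False by (simp add: restricted_truncation_def L_def \<mu>_def scale_sum_right)
    also have "\<dots> = (\<Sum>n\<in>L. smul (of_real (\<mu> / norm (xs n f))) (smul (xs n f) (x n)))"
      by (intro sum.cong) (auto simp: sgn_div_norm scaleR_conv_of_real field_simps)
    also have "qnorm \<dots> \<le> E * (C * qnorm f)"
      unfolding E_def
    proof (rule qnorm_box_combination_le[OF fin])
      show "qnorm (\<Sum>n\<in>B. smul (xs n f) (x n)) \<le> C * qnorm f" if "B \<subseteq> L" for B
        using C[OF f] that by (simp add: L_def coord_proj_def)
      show "0 \<le> \<mu> / norm (xs n f) \<and> \<mu> / norm (xs n f) \<le> 1" if "n \<in> L" for n
        using \<mu>[OF that] \<open>a \<le> \<mu>\<close> \<open>0 < a\<close> by (auto simp: divide_le_eq_1)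
    qed
    finally show ?thesis .
  qed
  then show ?thesis by (metis mult.assoc)
qed

text \<open>The infimum is itself an admissible constant: for nonzero \<open>f\<close> the quotient
  of the two norms is below every admissible constant, and for \<open>qnorm f = 0\<close> all the
  bounds are zero.\<close>

lemma qnorm_truncation_le:
  assumes "nearly_unconditional smul qnorm x xs" and "0 < a" "a < 1" and f: "f \<in> coord_ball xs"
  shows "qnorm (restricted_truncation smul x xs a f)
    \<le> truncation_quasi_greedy_fun smul qnorm x xs a * qnorm f"
proof (cases "qnorm f = 0")
  case True
  then show ?thesis using truncation_bounded[OF assms(1-3)] f by auto
next
  case False
  then have pos: "0 < qnorm f" using qnorm_nonneg[of f] by simp
  have "qnorm (restricted_truncation smul x xs a f) / qnorm f
      \<le> truncation_quasi_greedy_fun smul qnorm x xs a"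
    unfolding truncation_quasi_greedy_fun_def
    using truncation_bounded[OF assms(1-3)] f pos
    by (intro cInf_greatest) (auto simp: divide_le_eq)
  with pos show ?thesis by (simp add: divide_le_eq)
qed

text \<open>The truncation fixes \<open>x 0\<close>. This lower bound later lets a constant term be
  absorbed into a multiple of the truncation function.\<close>

lemma truncation_fun_ge_1:
  assumes "nearly_unconditional smul qnorm x xs" and "0 < a" "a < 1"
  shows "1 \<le> truncation_quasi_greedy_fun smul qnorm x xs a"
proof -
  have L: "large_coords xs a (x 0) = {0}"
    using assms by (auto simp: large_coords_def biorthogonal split: if_splits)
  have "x 0 \<in> coord_ball xs" by (simp add: coord_ball_def biorthogonal)
  from qnorm_truncation_le[OF assms this]
  have "qnorm (x 0) \<le> truncation_quasi_greedy_fun smul qnorm x xs a * qnorm (x 0)"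
    by (simp add: restricted_truncation_def L biorthogonal)
  moreover have "0 < qnorm (x 0)"
    using basis_nonzero[of 0] qnorm_eq_0_iff qnorm_nonneg[of "x 0"] by (simp add: less_le)
  ultimately show ?thesis by simp
qed

section \<open>Dyadic blocks of coefficients\<close>

text \<open>The sum over \<open>L\<close> lies in \<open>coord_ball xs\<close>, and all of
  \<open>L\<close> is above the level \<open>1/2\<close> for it. Any fixed level in
  \<open>(0,1)\<close> would do; what matters is that \<open>C\<close> does not depend on the level
  \<open>b\<close> used later.\<close>

lemma unimodular_sum_subset:
  assumes "nearly_unconditional smul qnorm x xs"
  obtains C where "0 \<le> C"
    and "\<And>L B c. finite L \<Longrightarrow> B \<subseteq> L \<Longrightarrow> (\<And>n. n \<in> L \<Longrightarrow> norm (c n) = 1) \<Longrightarrow>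
      qnorm (\<Sum>n\<in>B. smul (c n) (x n)) \<le> C * qnorm (\<Sum>n\<in>L. smul (c n) (x n))"
proof -
  obtain C where C: "\<And>f A. f \<in> coord_ball xs \<Longrightarrow> A \<subseteq> large_coords xs (1/2) f \<Longrightarrow>
      qnorm (coord_proj smul x xs A f) \<le> C * qnorm f"
    using nearly_unconditionalE[OF assms, of "1/2"] by auto
  show thesis
  proof (rule that[of "max C 0"])
    fix L B :: "nat set" and c :: "nat \<Rightarrow> 'k"
    assume fin: "finite L" and "B \<subseteq> L" and c: "\<And>n. n \<in> L \<Longrightarrow> norm (c n) = 1"
    define h where "h = (\<Sum>n\<in>L. smul (c n) (x n))"
    have h: "xs n h = (if n \<in> L then c n else 0)" for n
      unfolding h_def using fin by (rule coord_combination)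
    have "h \<in> coord_ball xs" by (simp add: coord_ball_def h c)
    moreover have "B \<subseteq> large_coords xs (1/2) h" using \<open>B \<subseteq> L\<close> by (auto simp: large_coords_def h c)
    ultimately have "qnorm (coord_proj smul x xs B h) \<le> C * qnorm h" by (rule C)
    also have "\<dots> \<le> max C 0 * qnorm h" using qnorm_nonneg by (intro mult_right_mono) auto
    also have "coord_proj smul x xs B h = (\<Sum>n\<in>B. smul (c n) (x n))"
      using \<open>B \<subseteq> L\<close> by (auto simp: coord_proj_def h intro!: sum.cong)
    finally show "qnorm (\<Sum>n\<in>B. smul (c n) (x n)) \<le> max C 0 * qnorm (\<Sum>n\<in>L. smul (c n) (x n))"
      by (simp add: h_def)
  qed simp
qed

text \<open>Dividing \<open>f\<close> by \<open>t \<ge> 1\<close> moves the level \<open>b t\<close> down to \<open>b\<close>, so \<open>\<lambda>(b)\<close> controls all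
  the levels above \<open>b\<close>.\<close>

lemma qnorm_level_sign_sum_le:
  assumes nu: "nearly_unconditional smul qnorm x xs" and b: "0 < b" "b < 1" and t: "1 \<le> t"
    and f: "f \<in> coord_ball xs"
  shows "b * t * qnorm (\<Sum>n\<in>large_coords xs (b * t) f. smul (sgn (xs n f)) (x n))
    \<le> truncation_quasi_greedy_fun smul qnorm x xs b * qnorm f"
proof -
  define L where "L = large_coords xs (b * t) f"
  define S where "S = (\<Sum>n\<in>L. smul (sgn (xs n f)) (x n))"
  define g where "g = smul (of_real (1/t)) f"
  have g: "xs n g = of_real (1/t) * xs n f" for n by (simp add: g_def coord_smul)
  have norm_g: "norm (xs n g) = norm (xs n f) / t" for n
    using t by (simp add: g norm_mult norm_divide)
  have sgn_g: "sgn (xs n g) = sgn (xs n f)" for n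
    using t by (simp add: g Real_Vector_Spaces.sgn_mult sgn_of_real del: of_real_divide)
  have Lg: "large_coords xs b g = L"
    using t by (auto simp: L_def large_coords_def norm_g field_simps)
  have fin: "finite L" using finite_large_coords b t by (simp add: L_def)
  have qg: "qnorm g = qnorm f / t" using t by (simp add: g_def qnorm_smul norm_divide)
  have "norm (xs n g) \<le> 1" for n
    using f t order_trans[of "norm (xs n f)" 1 t] by (simp add: norm_g coord_ball_def)
  then have gQ: "g \<in> coord_ball xs" by (simp add: coord_ball_def)
  \<comment> \<open>The minimum in the truncation of \<open>g\<close> is at least \<open>b\<close>,
    and the signs of \<open>g\<close> are those of \<open>f\<close>.\<close>
  have "b * qnorm S \<le> qnorm (restricted_truncation smul x xs b g)"
  proof (cases "L = {}")
    case True
    then show ?thesis using qnorm_eq_0_iff[of 0] qnorm_nonneg by (simp add: S_def)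
  next
    case False
    define \<mu> where "\<mu> = Min ((\<lambda>n. norm (xs n g)) ` L)"
    have "b \<le> \<mu>" unfolding \<mu>_def using False fin by (auto simp: Lg[symmetric] large_coords_def)
    moreover have "restricted_truncation smul x xs b g = smul (of_real \<mu>) S"
      using False by (simp add: restricted_truncation_def Lg \<mu>_def S_def sgn_g)
    ultimately show ?thesis using b qnorm_nonneg by (simp add: qnorm_smul mult_right_mono)
  qed
  also have "\<dots> \<le> truncation_quasi_greedy_fun smul qnorm x xs b * (qnorm f / t)"
    using qnorm_truncation_le[OF nu b gQ] by (simp add: qg)
  finally show ?thesis using t by (simp add: S_def L_def field_simps)
qed

text \<open>Up to the factor \<open>2 * (b * t)\<close>, the coefficients on \<open>B\<close> are
  signs with weights in \<open>[0,1]\<close>. The box bound passes to sign sums over subsets of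
  \<open>B\<close>, these are controlled by the sign sum over the whole of
  \<open>large_coords xs (b * t) f\<close>, and that one by the truncation function at
  \<open>b\<close>.\<close>

lemma qnorm_dyadic_block_le:
  assumes nu: "nearly_unconditional smul qnorm x xs"
  obtains C where "0 \<le> C"
    and "\<And>b t f B. 0 < b \<Longrightarrow> b < 1 \<Longrightarrow> 1 \<le> t \<Longrightarrow> f \<in> coord_ball xs \<Longrightarrow>
      (\<And>n. n \<in> B \<Longrightarrow> b * t \<le> norm (xs n f) \<and> norm (xs n f) \<le> 2 * (b * t)) \<Longrightarrow>
      qnorm (coord_proj smul x xs B f) \<le> C * truncation_quasi_greedy_fun smul qnorm x xs b * qnorm f"
proof -
  obtain C where C: "0 \<le> C"
    "\<And>L B c. finite L \<Longrightarrow> B \<subseteq> L \<Longrightarrow> (\<And>n. n \<in> L \<Longrightarrow> norm (c n) = 1) \<Longrightarrow>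
      qnorm (\<Sum>n\<in>B. smul (c n) (x n)) \<le> C * qnorm (\<Sum>n\<in>L. smul (c n) (x n))"
    using unimodular_sum_subset[OF nu] by blast
  define E where "E = (1 / (2 powr p - 1)) powr (1/p)"
  have "0 \<le> E" by (simp add: E_def)
  show thesis
  \<comment> \<open>The factors come from the upper end of the block, the box bound and the passage
    to subsets.\<close>
  proof (rule that[of "2 * E * C"])
    show "0 \<le> 2 * E * C" using C(1) \<open>0 \<le> E\<close> by simp
    fix b t :: real and f B
    assume b: "0 < b" "b < 1" and t: "1 \<le> t" and f: "f \<in> coord_ball xs"
      and B: "\<And>n. n \<in> B \<Longrightarrow> b * t \<le> norm (xs n f) \<and> norm (xs n f) \<le> 2 * (b * t)"
    define L where "L = large_coords xs (b * t) f"
    define T where "T = qnorm (\<Sum>n\<in>L. smul (sgn (xs n f)) (x n))"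
    have bt: "0 < b * t" using b t by simp
    have fin: "finite L" using finite_large_coords bt by (simp add: L_def)
    have "B \<subseteq> L" using B by (auto simp: L_def large_coords_def)
    have "norm (sgn (xs n f)) = 1" if "n \<in> L" for n
      using that bt by (auto simp: L_def large_coords_def norm_sgn)
    then have sub: "qnorm (\<Sum>n\<in>B'. smul (sgn (xs n f)) (x n)) \<le> C * T" if "B' \<subseteq> B" for B'
      unfolding T_def using C(2)[OF fin, of B' "\<lambda>n. sgn (xs n f)"] that \<open>B \<subseteq> L\<close> by auto
    define a where "a n = norm (xs n f) / (2 * (b * t))" for n
    have "xs n f = of_real (2 * (b * t)) * (of_real (a n) * sgn (xs n f))" for n
      using bt by (cases "xs n f = 0") (auto simp: a_def sgn_div_norm scaleR_conv_of_real field_simps)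
    then have "smul (xs n f) (x n)
        = smul (of_real (2 * (b * t))) (smul (of_real (a n)) (smul (sgn (xs n f)) (x n)))" for n
      by (metis scale_scale)
    then have "coord_proj smul x xs B f
        = smul (of_real (2 * (b * t))) (\<Sum>n\<in>B. smul (of_real (a n)) (smul (sgn (xs n f)) (x n)))"
      unfolding coord_proj_def by (simp only: scale_sum_right)
    then have "qnorm (coord_proj smul x xs B f)
        = 2 * (b * t) * qnorm (\<Sum>n\<in>B. smul (of_real (a n)) (smul (sgn (xs n f)) (x n)))"
      using bt by (simp only: qnorm_smul norm_of_real)
    also have "\<dots> \<le> 2 * (b * t) * (E * (C * T))"
      unfolding E_def using bt B finite_subset[OF \<open>B \<subseteq> L\<close> fin] sub
      by (intro mult_left_mono qnorm_box_combination_le) (auto simp: a_def divide_le_eq_1)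
    also have "\<dots> = 2 * E * C * (b * t * T)" by simp
    also have "\<dots> \<le> 2 * E * C * (truncation_quasi_greedy_fun smul qnorm x xs b * qnorm f)"
      using qnorm_level_sign_sum_le[OF nu b t f] C(1) \<open>0 \<le> E\<close>
      by (intro mult_left_mono) (auto simp: T_def L_def)
    finally show "qnorm (coord_proj smul x xs B f)
        \<le> 2 * E * C * truncation_quasi_greedy_fun smul qnorm x xs b * qnorm f"
      by (simp add: mult.assoc)
  qed
qed

section \<open>Summation over the dyadic levels\<close>

text \<open>Induction on \<open>J\<close>: each step splits off one dyadic block, at the cost of
  \<open>M powr p\<close>. The base case consists of the coefficients below \<open>b\<close>, whose
  terms have norm at most \<open>b * V\<close>.\<close>

lemma qnorm_coord_proj_levels:
  assumes "finite A" and V: "\<And>n. qnorm (x n) \<le> V" and b: "0 < b"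
    and M: "\<And>j B. finite B \<Longrightarrow> (\<And>n. n \<in> B \<Longrightarrow> b * 2 ^ j \<le> norm (xs n f) \<and> norm (xs n f) \<le> 2 * (b * 2 ^ j)) \<Longrightarrow>
      qnorm (coord_proj smul x xs B f) \<le> M"
  shows "qnorm (coord_proj smul x xs {n\<in>A. norm (xs n f) < b * 2 ^ J} f) powr p
    \<le> real (card A) * (b * V) powr p + real J * M powr p"
proof (induction J)
  case 0
  define A0 where "A0 = {n\<in>A. norm (xs n f) < b * 2 ^ 0}"
  have A0: "finite A0" "card A0 \<le> card A" using \<open>finite A\<close> by (auto simp: A0_def intro: card_mono)
  have "qnorm (\<Sum>n\<in>A0. smul (xs n f) (x n)) powr p \<le> real (card A0) * (b * V) powr p"
    using V b qnorm_nonneg A0 by (intro qnorm_sum_le) (auto simp: A0_def qnorm_smul intro!: mult_mono)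
  also have "\<dots> \<le> real (card A) * (b * V) powr p" using A0 by (intro mult_right_mono) auto
  finally show ?case by (simp add: A0_def coord_proj_def)
next
  case (Suc J)
  define A' where "A' = {n\<in>A. norm (xs n f) < b * 2 ^ J}"
  define B where "B = {n\<in>A. b * 2 ^ J \<le> norm (xs n f) \<and> norm (xs n f) < b * 2 ^ Suc J}"
  have fin: "finite A'" "finite B" using \<open>finite A\<close> by (auto simp: A'_def B_def)
  have "b * 2 ^ J \<le> b * 2 ^ Suc J" using b by simp
  then have "{n\<in>A. norm (xs n f) < b * 2 ^ Suc J} = A' \<union> B" unfolding A'_def B_def by force
  moreover have "A' \<inter> B = {}" by (auto simp: A'_def B_def)
  ultimately have "coord_proj smul x xs {n\<in>A. norm (xs n f) < b * 2 ^ Suc J} f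
      = coord_proj smul x xs A' f + coord_proj smul x xs B f"
    using fin by (simp add: coord_proj_def sum.union_disjoint)
  moreover have "qnorm (coord_proj smul x xs B f) powr p \<le> M powr p"
    using fin p_pos qnorm_nonneg by (intro powr_mono2 M[of B J]) (auto simp: B_def)
  ultimately show ?case
    using qnorm_add[of "coord_proj smul x xs A' f" "coord_proj smul x xs B f"] Suc.IH
    by (simp add: A'_def[symmetric] distrib_right)
qed

lemma unconditionality_const_le:
  assumes nu: "nearly_unconditional smul qnorm x xs"
  shows "\<exists>K. \<forall>m::nat. 2 \<le> m \<longrightarrow>
    unconditionality_const smul qnorm x xs m
      \<le> K * truncation_quasi_greedy_fun smul qnorm x xs (1 / real m powr (1 / p))
          * ln (real m) powr (1 / p)"
proof -
  obtain C where C: "0 \<le> C"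
    "\<And>b t f B. 0 < b \<Longrightarrow> b < 1 \<Longrightarrow> 1 \<le> t \<Longrightarrow> f \<in> coord_ball xs \<Longrightarrow>
      (\<And>n. n \<in> B \<Longrightarrow> b * t \<le> norm (xs n f) \<and> norm (xs n f) \<le> 2 * (b * t)) \<Longrightarrow>
      qnorm (coord_proj smul x xs B f) \<le> C * truncation_quasi_greedy_fun smul qnorm x xs b * qnorm f"
    using qnorm_dyadic_block_le[OF nu] by blast
  obtain V where V: "\<And>n. qnorm (x n) \<le> V" using bounded_basis by blast
  have "0 \<le> V" using order_trans[OF qnorm_nonneg V] .
  obtain D where D: "1 \<le> D" "\<And>n f. norm (xs n f) \<le> D * qnorm f"
    using coords_bound by blast
  \<comment> \<open>The summands account for the coefficients below \<open>b\<close> and for the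
    dyadic levels, each relative to \<open>lam powr p * ln (real m)\<close>.\<close>
  define W where "W = V powr p / ln 2 + 3 / (p * ln 2) * C powr p"
  have W: "0 \<le> W" using p_pos by (simp add: W_def)
  show ?thesis
  proof (intro exI[of _ "D * W powr (1/p)"] allI impI)
    fix m :: nat
    assume m: "2 \<le> m"
    define b where "b = 1 / real m powr (1 / p)"
    define lam where "lam = truncation_quasi_greedy_fun smul qnorm x xs b"
    have b: "0 < b" "b < 1" using m p_pos by (auto simp: b_def)
    have lam: "1 \<le> lam" unfolding lam_def by (rule truncation_fun_ge_1[OF nu b])
    have ln2: "0 < ln (2::real)" "ln 2 \<le> ln (real m)" using m by auto
    \<comment> \<open>The added 1 makes \<open>1 < b * 2 ^ J\<close> strict, so every coefficient of
      a vector in \<open>coord_ball xs\<close> lies below the top level. As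
      \<open>log 2 (real m) / p \<ge> 1\<close>, rounding up and adding 1 costs at most a factor
      3.\<close>
    define J where "J = nat \<lceil>log 2 (real m) / p\<rceil> + 1"
    have "1 \<le> log 2 (real m)" using m by (simp add: le_log_iff)
    then have "1 \<le> log 2 (real m) / p" using p_pos p_le_1 by (simp add: le_divide_eq)
    then have "log 2 (real m) / p < real J" and "real J \<le> 3 * (log 2 (real m) / p)"
      unfolding J_def by linarith+
    then have J: "log 2 (real m) / p < real J" "real J \<le> 3 / (p * ln 2) * ln (real m)"
      by (simp_all add: log_def mult.commute)
    have "real m powr (1/p) = 2 powr (log 2 (real m) / p)" using m ln2 by (simp add: powr_def log_def)
    also have "\<dots> < 2 powr real J" using J by simp
    finally have bJ: "1 < b * 2 ^ J" using m by (simp add: b_def powr_realpow field_simps)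
    have "qnorm (coord_proj smul x xs A f) \<le> D * W powr (1/p) * lam * ln (real m) powr (1/p)"
      if A: "finite A" "card A \<le> m" and f: "qnorm f \<le> 1" for A f
    proof -
      define g where "g = smul (of_real (1/D)) f"
      have qg: "qnorm g = qnorm f / D" using D(1) by (simp add: g_def qnorm_smul norm_divide)
      have fg: "xs n f = of_real D * xs n g" for n using D(1) by (simp add: g_def coord_smul)
      have "norm (xs n g) \<le> 1" for n
        using D(2)[of n g] f D(1) by (simp add: qg)
      then have gQ: "g \<in> coord_ball xs" and top: "norm (xs n g) < b * 2 ^ J" for n
        using bJ by (auto simp: coord_ball_def intro: le_less_trans)
      have "qnorm g \<le> 1" using f D(1) by (simp add: qg)
      then have "qnorm (coord_proj smul x xs B g) \<le> C * lam"
        if "\<And>n. n \<in> B \<Longrightarrow> b * 2 ^ j \<le> norm (xs n g) \<and> norm (xs n g) \<le> 2 * (b * 2 ^ j)" for j B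
        using C(2)[where t = "2 ^ j", OF b _ gQ that] mult_left_mono[of "qnorm g" 1 "C * lam"] C(1) lam
        by (auto simp: lam_def intro: order_trans)
      then have "qnorm (coord_proj smul x xs {n\<in>A. norm (xs n g) < b * 2 ^ J} g) powr p
          \<le> real (card A) * (b * V) powr p + real J * (C * lam) powr p"
        using qnorm_coord_proj_levels[OF A(1) V b(1)] by blast
      also have "{n\<in>A. norm (xs n g) < b * 2 ^ J} = A" using top by simp
      also have "real (card A) * (b * V) powr p \<le> real m * (b * V) powr p"
        using A(2) by (intro mult_right_mono) auto
      \<comment> \<open>The level \<open>b\<close> was chosen so that
        \<open>b powr p = 1 / m\<close>, which cancels the number of terms.\<close>
      also have "\<dots> = V powr p"
        using m p_pos \<open>0 \<le> V\<close> by (simp add: b_def powr_mult powr_divide powr_powr)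
      \<comment> \<open>The constant contribution is absorbed by means of \<open>1 \<le> lam\<close>
        and \<open>ln 2 \<le> ln (real m)\<close>.\<close>
      also have "V powr p \<le> V powr p / ln 2 * (lam powr p * ln (real m))"
      proof -
        have "1 * ln 2 \<le> lam powr p * ln (real m)"
          using lam ln2 p_pos by (intro mult_mono ge_one_powr_ge_zero) auto
        from mult_left_mono[OF this, of "V powr p / ln 2"] show ?thesis by simp
      qed
      also have "real J * (C * lam) powr p \<le> 3 / (p * ln 2) * ln (real m) * (C * lam) powr p"
        using J(2) by (intro mult_right_mono) auto
      also have "V powr p / ln 2 * (lam powr p * ln (real m)) + \<dots> = W * (lam powr p * ln (real m))"
        using C(1) lam by (simp add: W_def powr_mult distrib_right)
      finally have *: "qnorm (coord_proj smul x xs A g) powr p \<le> W * (lam powr p * ln (real m))"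
        by simp
      have "qnorm (coord_proj smul x xs A g) = (qnorm (coord_proj smul x xs A g) powr p) powr (1/p)"
        using p_pos qnorm_nonneg by (simp add: powr_powr)
      also have "\<dots> \<le> (W * (lam powr p * ln (real m))) powr (1/p)"
        using * p_pos by (intro powr_mono2) auto
      also have "\<dots> = W powr (1/p) * lam * ln (real m) powr (1/p)"
        using W lam p_pos ln2 by (simp add: powr_mult powr_powr)
      finally have "D * qnorm (coord_proj smul x xs A g) \<le> D * (W powr (1/p) * lam * ln (real m) powr (1/p))"
        using D(1) by (intro mult_left_mono) auto
      moreover have "coord_proj smul x xs A f = smul (of_real D) (coord_proj smul x xs A g)"
        by (simp add: coord_proj_def fg scale_sum_right)
      ultimately show ?thesis using D(1) by (simp add: qnorm_smul mult.assoc)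
    qed
    \<comment> \<open>Once the index sets are nonempty, the uniform bound passes to both
      suprema.\<close>
    moreover have "{f. qnorm f \<le> 1} \<noteq> {}" using qnorm_eq_0_iff[of 0] by (auto intro!: exI[of _ 0])
    moreover have "{A :: nat set. finite A \<and> card A \<le> m} \<noteq> {}" by (auto intro!: exI[of _ "{}"])
    ultimately show "unconditionality_const smul qnorm x xs m
        \<le> D * W powr (1/p) * truncation_quasi_greedy_fun smul qnorm x xs (1 / real m powr (1/p))
          * ln (real m) powr (1/p)"
      unfolding unconditionality_const_def op_qnorm_def lam_def b_def
      by (intro cSUP_least) auto
  qed
qed

end

theorem theorem3p7:
  fixes smul :: "'k::real_normed_field \<Rightarrow> 'a::ab_group_add \<Rightarrow> 'a"
    and qnorm :: "'a \<Rightarrow> real" and p :: real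
    and x :: "nat \<Rightarrow> 'a" and xs :: "nat \<Rightarrow> 'a \<Rightarrow> 'k"
  assumes "p_Banach_basis smul qnorm p x xs"
    and "nearly_unconditional smul qnorm x xs"
  shows "\<exists>K. \<forall>m::nat. 2 \<le> m \<longrightarrow>
    unconditionality_const smul qnorm x xs m
      \<le> K * truncation_quasi_greedy_fun smul qnorm x xs (1 / real m powr (1 / p))
          * ln (real m) powr (1 / p)"
  using assms by (rule p_Banach_basis.unconditionality_const_le)

end
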